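(* If $S_{\boldsymbol\lambda}$ is a densely defined weighted shift on a directed tree $\mathcal T=(V,E)$ with weights $\boldsymbol\lambda=\{\lambda_v\}_{v\in V^\circ}$, then the following conditions are equivalent: (i) $\mathcal D(S_{\boldsymbol\lambda})\subseteq\mathcal D(S_{\boldsymbol\lambda}^* )$; (ii) there exists $c>0$ such that $$\sum_{v\in\operatorname{Chi}(u)}\frac{|\lambda_v|^2}{1+\|S_{\boldsymbol\lambda}e_v\|^2}\le c,\qquad u\in V.$$
   Context: A directed tree $\mathcal T=(V,E)$ consists of a nonempty set $V$ (of arbitrary cardinality) of vertices and a set $E\subseteq V\times V\setminus\{(v,v):v\in V\}$ of edges such that: (1) any two distinct vertices $u,v$ are joined by an undirected path, i.e. there are $v_1=u,\dots,v_n=v$ in $V$ ($n\ge 2$) with $(v_j,v_{j+1})\in E$ or $(v_{j+1},v_j)\in E$ for each $j<n$; (2) there is no circuit, i.e. no finite sequence of distinct vertices $u_1,\dots,u_n$ ($n\ge2$) with $(u_j,u_{j+1})\in E$ for $j<n$ and $(u_n,u_1)\in E$; (3) every vertex $v$ that is not a root has a unique vertex $\operatorname{par}(v)$ (its parent) with $(\operatorname{par}(v),v)\in E$; a root is a vertex $v$ for which there is no $u$ with $(u,v)\in E$. A directed tree has at most one root, denoted $\mathrm{root}$ when it exists. $V^\circ$ is $V$ with the root removed (and $V^\circ=V$ if $\mathcal T$ has no root). $\operatorname{Chi}(u)=\{v\in V:(u,v)\in E\}$. $\ell^2(V)$ is the Hilbert space of square summable complex functions on $V$, with orthonormal basis $\{e_u\}_{u\in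 V}$, $e_u$ being the indicator function of $\{u\}$. For $\boldsymbol\lambda=\{\lambda_v\}_{v\in V^\circ}\subseteq\mathbb C$ and $f\colon V\to\mathbb C$ put $(\Lambda f)(v)=\lambda_v f(\operatorname{par}(v))$ for $v\in V^\circ$ and $(\Lambda f)(\mathrm{root})=0$. The weighted shift $S_{\boldsymbol\lambda}$ is the operator in $\ell^2(V)$ with domain $\mathcal D(S_{\boldsymbol\lambda})=\{f\in\ell^2(V):\Lambda f\in\ell^2(V)\}$ and $S_{\boldsymbol\lambda}f=\Lambda f$. It is densely defined if and only if every $e_u$ lies in its domain, in which case $\|S_{\boldsymbol\lambda}e_u\|^2=\sum_{v\in\operatorname{Chi}(u)}|\lambda_v|^2<\infty$. Sums over the empty set are $0$. *)

theory Defs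
  imports "HOL-Analysis.Analysis"
begin

section \<open>Directed trees\<close>

definition is_root :: "'v set \<Rightarrow> ('v \<times> 'v) set \<Rightarrow> 'v \<Rightarrow> bool" where
  "is_root V E v \<longleftrightarrow> v \<in> V \<and> (\<forall>u\<in>V. (u, v) \<notin> E)"

definition nonroots :: "'v set \<Rightarrow> ('v \<times> 'v) set \<Rightarrow> 'v set" where
  "nonroots V E = {v \<in> V. \<not> is_root V E v}"

definition Chi :: "'v set \<Rightarrow> ('v \<times> 'v) set \<Rightarrow> 'v \<Rightarrow> 'v set" where
  "Chi V E u = {v \<in> V. (u, v) \<in> E}"

definition par :: "'v set \<Rightarrow> ('v \<times> 'v) set \<Rightarrow> 'v \<Rightarrow> 'v" where
  "par V E v = (THE u. u \<in> V \<and> (u, v) \<in> E)"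

locale directed_tree =
  fixes V :: "'v set" and E :: "('v \<times> 'v) set"
  assumes nonempty: "V \<noteq> {}"
    and edges: "E \<subseteq> V \<times> V - {(v, v) | v. v \<in> V}"
    and connected: "\<And>u v. u \<in> V \<Longrightarrow> v \<in> V \<Longrightarrow> u \<noteq> v \<Longrightarrow>
      \<exists>ws. 2 \<le> length ws \<and> set ws \<subseteq> V \<and> hd ws = u \<and> last ws = v \<and>
        successively (\<lambda>x y. (x, y) \<in> E \<or> (y, x) \<in> E) ws"
    and no_circuit: "\<not> (\<exists>us. 2 \<le> length us \<and> set us \<subseteq> V \<and> distinct us \<and>
        successively (\<lambda>x y. (x, y) \<in> E) us \<and> (last us, hd us) \<in> E)"
    and unique_parent: "\<And>v. v \<in> V \<Longrightarrow> \<not> is_root V E v \<Longrightarrow> \<exists>!u. u \<in> V \<and> (u, v) \<in> E"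


section \<open>The Hilbert space of square summable functions on a set\<close>

text \<open>A complex function on \<open>V\<close> is represented by a function on the whole type that vanishes
  outside \<open>V\<close>, so that equality of elements of \<open>ell2 V\<close> is equality of functions on \<open>V\<close>.\<close>

definition ell2 :: "'v set \<Rightarrow> ('v \<Rightarrow> complex) set" where
  "ell2 V = {f. (\<forall>v. v \<notin> V \<longrightarrow> f v = 0) \<and> (\<lambda>v. (cmod (f v))\<^sup>2) summable_on V}"

definition ell2_inner :: "'v set \<Rightarrow> ('v \<Rightarrow> complex) \<Rightarrow> ('v \<Rightarrow> complex) \<Rightarrow> complex" where
  "ell2_inner V f g = (\<Sum>\<^sub>\<infinity>v\<in>V. f v * cnj (g v))"

definition ell2_norm :: "'v set \<Rightarrow> ('v \<Rightarrow> complex) \<Rightarrow> real" where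
  "ell2_norm V f = sqrt (\<Sum>\<^sub>\<infinity>v\<in>V. (cmod (f v))\<^sup>2)"

definition ell2_basis :: "'v \<Rightarrow> 'v \<Rightarrow> complex" where
  "ell2_basis u = indicator {u}"


section \<open>Unbounded operators and their adjoints\<close>

text \<open>An operator is a domain together with a map; the values of the map off the domain are
  irrelevant.\<close>

type_synonym 'v ell2_operator =
  "('v \<Rightarrow> complex) set \<times> (('v \<Rightarrow> complex) \<Rightarrow> ('v \<Rightarrow> complex))"

abbreviation op_domain :: "'v ell2_operator \<Rightarrow> ('v \<Rightarrow> complex) set" where
  "op_domain T \<equiv> fst T"

abbreviation op_apply :: "'v ell2_operator \<Rightarrow> ('v \<Rightarrow> complex) \<Rightarrow> ('v \<Rightarrow> complex)" where
  "op_apply T \<equiv> snd T"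

definition densely_defined :: "'v set \<Rightarrow> 'v ell2_operator \<Rightarrow> bool" where
  "densely_defined V T \<longleftrightarrow> op_domain T \<subseteq> ell2 V \<and>
     (\<forall>f\<in>ell2 V. \<forall>\<epsilon>>0. \<exists>g\<in>op_domain T. ell2_norm V (\<lambda>v. f v - g v) < \<epsilon>)"

text \<open>The value of the adjoint is uniquely determined only for densely defined operators.\<close>

definition op_adjoint :: "'v set \<Rightarrow> 'v ell2_operator \<Rightarrow> 'v ell2_operator" where
  "op_adjoint V T =
     ({g \<in> ell2 V. \<exists>h\<in>ell2 V. \<forall>f\<in>op_domain T.
         ell2_inner V (op_apply T f) g = ell2_inner V f h},
      \<lambda>g. THE h. h \<in> ell2 V \<and>
         (\<forall>f\<in>op_domain T. ell2_inner V (op_apply T f) g = ell2_inner V f h))"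


section \<open>Weighted shifts\<close>

definition shift_map ::
  "'v set \<Rightarrow> ('v \<times> 'v) set \<Rightarrow> ('v \<Rightarrow> complex) \<Rightarrow> ('v \<Rightarrow> complex) \<Rightarrow> 'v \<Rightarrow> complex" where
  "shift_map V E w f v = (if v \<in> nonroots V E then w v * f (par V E v) else 0)"

definition weighted_shift ::
  "'v set \<Rightarrow> ('v \<times> 'v) set \<Rightarrow> ('v \<Rightarrow> complex) \<Rightarrow> 'v ell2_operator" where
  "weighted_shift V E w = ({f \<in> ell2 V. shift_map V E w f \<in> ell2 V}, shift_map V E w)"

end

theory Submission imports Defs begin

text \<open>The sets \<open>Chi u\<close>, \<open>u \<in> V\<close>, partition the set of non-root vertices, so sums over the latter can be
  regrouped. Put \<open>a v = \<parallel>S e\<^sub>v\<parallel>\<^sup>2\<close> and let \<open>s u\<close> be the sum in condition (ii). Then \<open>f\<close> is in the domain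
  of \<open>S\<close> iff \<open>\<Sum> (1 + a v) |f v|\<^sup>2 < \<infinity>\<close>, and \<open>(S\<^sup>* g)(u)\<close> is the sum of \<open>cnj (w v) * g v\<close> over \<open>Chi u\<close>.
  If \<open>s \<le> c\<close>, the Cauchy--Schwarz inequality on \<open>Chi u\<close> with the weights \<open>1 + a v\<close> gives
  \<open>\<parallel>S\<^sup>* f\<parallel>\<^sup>2 \<le> c (\<parallel>f\<parallel>\<^sup>2 + \<parallel>S f\<parallel>\<^sup>2)\<close>. If \<open>s\<close> is unbounded, choose distinct vertices \<open>u\<^sub>n\<close> with
  \<open>s u\<^sub>n \<ge> 2\<^sup>n\<close> and put \<open>f v = w v / ((1 + a v) s u\<^sub>n)\<close> on \<open>Chi u\<^sub>n\<close>; then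
  \<open>\<parallel>f\<parallel>\<^sup>2 + \<parallel>S f\<parallel>\<^sup>2 = \<Sum> 1 / s u\<^sub>n < \<infinity>\<close>, whereas \<open>(S\<^sup>* f)(u\<^sub>n)\<close> would have to be \<open>1\<close> for every \<open>n\<close>.\<close>

section \<open>Infinite sums\<close>

text \<open>The inequality for finite sums passes to the limit along the filter of finite subsets of
  \<open>A\<close>.\<close>

lemma Cauchy_Schwarz_infsum:
  fixes x y :: "'a \<Rightarrow> real"
  assumes x: "(\<lambda>i. (x i)\<^sup>2) summable_on A" and y: "(\<lambda>i. (y i)\<^sup>2) summable_on A"
  shows "(\<lambda>i. x i * y i) summable_on A"
    and "(\<Sum>\<^sub>\<infinity>i\<in>A. x i * y i)\<^sup>2 \<le> (\<Sum>\<^sub>\<infinity>i\<in>A. (x i)\<^sup>2) * (\<Sum>\<^sub>\<infinity>i\<in>A. (y i)\<^sup>2)"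
proof -
  have "(\<lambda>i. norm (x i * y i)) summable_on A"
    by (rule abs_summable_product) (use x y in \<open>simp_all add: power2_eq_square\<close>)
  then show s: "(\<lambda>i. x i * y i) summable_on A"
    by (rule abs_summable_summable)
  have "((\<lambda>F. (\<Sum>i\<in>F. x i * y i)\<^sup>2) \<longlongrightarrow> (\<Sum>\<^sub>\<infinity>i\<in>A. x i * y i)\<^sup>2) (finite_subsets_at_top A)"
    by (intro tendsto_power infsum_tendsto s)
  moreover have "((\<lambda>F. (\<Sum>i\<in>F. (x i)\<^sup>2) * (\<Sum>i\<in>F. (y i)\<^sup>2)) \<longlongrightarrow>
      (\<Sum>\<^sub>\<infinity>i\<in>A. (x i)\<^sup>2) * (\<Sum>\<^sub>\<infinity>i\<in>A. (y i)\<^sup>2)) (finite_subsets_at_top A)"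
    by (intro tendsto_mult infsum_tendsto x y)
  ultimately show "(\<Sum>\<^sub>\<infinity>i\<in>A. x i * y i)\<^sup>2 \<le> (\<Sum>\<^sub>\<infinity>i\<in>A. (x i)\<^sup>2) * (\<Sum>\<^sub>\<infinity>i\<in>A. (y i)\<^sup>2)"
    by (intro tendsto_le[OF finite_subsets_at_top_neq_bot])
      (auto intro!: always_eventually Cauchy_Schwarz_ineq_sum)
qed

lemma infsum_ge_term:
  fixes f :: "'a \<Rightarrow> real"
  assumes "f summable_on A" "\<And>x. x \<in> A \<Longrightarrow> f x \<ge> 0" "a \<in> A"
  shows "f a \<le> infsum f A"
  using finite_sum_le_infsum[OF assms(1), of "{a}"] assms by simp

section \<open>Square summable functions\<close>

lemma ell2_inner_summable:
  assumes "f \<in> ell2 V" "g \<in> ell2 V"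
  shows "(\<lambda>v. f v * cnj (g v)) summable_on V"
proof -
  have "(\<lambda>v. cmod (f v) * cmod (g v)) summable_on V"
    by (rule Cauchy_Schwarz_infsum) (use assms in \<open>auto simp: ell2_def\<close>)
  then have "(\<lambda>v. norm (f v * cnj (g v))) summable_on V"
    by (simp add: norm_mult)
  then show ?thesis
    by (rule abs_summable_summable)
qed

lemma ell2_diff:
  assumes "f \<in> ell2 V" "g \<in> ell2 V"
  shows "(\<lambda>v. f v - g v) \<in> ell2 V"
proof -
  have "(\<lambda>v. 2 * (cmod (f v))\<^sup>2 + 2 * (cmod (g v))\<^sup>2) summable_on V"
    using assms by (intro summable_on_add summable_on_cmult_right) (auto simp: ell2_def)
  moreover have "(cmod (f v - g v))\<^sup>2 \<le> 2 * (cmod (f v))\<^sup>2 + 2 * (cmod (g v))\<^sup>2" for v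
  proof -
    have "(cmod (f v - g v))\<^sup>2 \<le> (cmod (f v) + cmod (g v))\<^sup>2"
      by (intro power_mono norm_triangle_ineq4) simp
    also have "\<dots> \<le> 2 * (cmod (f v))\<^sup>2 + 2 * (cmod (g v))\<^sup>2"
      \<comment> \<open>This instance says that the square of \<open>cmod (f v) - cmod (g v)\<close>
        is nonnegative.\<close>
      using sum_squares_ge_zero[of "cmod (f v) - cmod (g v)" 0]
      by (simp add: power2_eq_square algebra_simps)
    finally show ?thesis .
  qed
  ultimately show ?thesis
    using assms by (auto simp: ell2_def intro: summable_on_comparison_test)
qed

lemma ell2_basis_in_ell2: "u \<in> V \<Longrightarrow> ell2_basis u \<in> ell2 V"
proof -
  assume u: "u \<in> V"
  have "(\<lambda>v. (cmod (ell2_basis u v))\<^sup>2) summable_on V \<longleftrightarrow>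
      (\<lambda>v. (cmod (ell2_basis u v))\<^sup>2) summable_on {u}"
    by (rule summable_on_cong_neutral) (use u in \<open>auto simp: ell2_basis_def\<close>)
  then show ?thesis
    using u by (auto simp: ell2_def ell2_basis_def indicator_def)
qed

lemma norm_le_ell2_norm:
  assumes "f \<in> ell2 V" "v \<in> V"
  shows "cmod (f v) \<le> ell2_norm V f"
  unfolding ell2_norm_def
  using assms by (intro real_le_rsqrt infsum_ge_term[where f = "\<lambda>v. (cmod (f v))\<^sup>2"])
    (auto simp: ell2_def)


section \<open>Regrouping sums over children\<close>

context directed_tree
begin

lemma par_eq: "u \<in> V \<Longrightarrow> v \<in> Chi V E u \<Longrightarrow> par V E v = u"
  using unique_parent[of v] unfolding par_def Chi_def is_root_def
  by (intro the_equality) auto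

lemma Chi_subset_nonroots: "u \<in> V \<Longrightarrow> Chi V E u \<subseteq> nonroots V E"
  by (auto simp: Chi_def nonroots_def is_root_def)

lemma nonroots_subset: "nonroots V E \<subseteq> V"
  by (auto simp: nonroots_def)

text \<open>Each non-root vertex is a child of exactly one vertex, its parent. Hence a sum over
  \<open>nonroots V E\<close> is, after reindexing, a sum over a disjoint union of the sets of
  children.\<close>

lemma bij_betw_Sigma_Chi: "bij_betw snd (Sigma V (Chi V E)) (nonroots V E)"
proof (rule bij_betwI')
  fix p q assume "p \<in> Sigma V (Chi V E)" "q \<in> Sigma V (Chi V E)"
  then show "snd p = snd q \<longleftrightarrow> p = q"
    using par_eq by (metis SigmaE snd_conv)
next
  fix p assume "p \<in> Sigma V (Chi V E)"
  then show "snd p \<in> nonroots V E"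
    using Chi_subset_nonroots by fastforce
next
  fix v assume "v \<in> nonroots V E"
  then show "\<exists>p\<in>Sigma V (Chi V E). v = snd p"
    by (force simp: nonroots_def is_root_def Chi_def)
qed

text \<open>Nonnegativity lets convergence of the iterated sum imply convergence of the joint one.
  Summability on each fibre is assumed because \<open>infsum\<close> is \<open>0\<close> on a
  divergent fibre, which would falsify the equivalence.\<close>

lemma summable_on_nonroots_iff:
  fixes F :: "'v \<Rightarrow> real"
  assumes "\<And>v. F v \<ge> 0" and F: "\<And>u. u \<in> V \<Longrightarrow> F summable_on Chi V E u"
  shows "F summable_on nonroots V E \<longleftrightarrow> (\<lambda>u. infsum F (Chi V E u)) summable_on V"
proof -
  have "F summable_on nonroots V E \<longleftrightarrow> (\<lambda>p. F (snd p)) summable_on Sigma V (Chi V E)"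
    using summable_on_reindex_bij_betw[OF bij_betw_Sigma_Chi] by metis
  also have "\<dots> \<longleftrightarrow> (\<lambda>u. infsum F (Chi V E u)) summable_on V"
  proof
    assume "(\<lambda>p. F (snd p)) summable_on Sigma V (Chi V E)"
    then show "(\<lambda>u. infsum F (Chi V E u)) summable_on V"
      using summable_on_Sigma_banach[of "\<lambda>_. F" V "Chi V E"] by (simp add: case_prod_unfold)
  next
    assume "(\<lambda>u. infsum F (Chi V E u)) summable_on V"
    then show "(\<lambda>p. F (snd p)) summable_on Sigma V (Chi V E)"
      by (rule summable_on_SigmaI[rotated]) (use assms in \<open>auto intro: has_sum_infsum\<close>)
  qed
  finally show ?thesis .
qed

text \<open>With joint summability given, no sign condition is involved, so the identity covers the
  complex terms of an inner product.\<close>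

lemma infsum_nonroots:
  fixes F :: "'v \<Rightarrow> 'b::banach"
  assumes "F summable_on nonroots V E"
  shows "infsum F (nonroots V E) = (\<Sum>\<^sub>\<infinity>u\<in>V. infsum F (Chi V E u))"
proof -
  have "(\<lambda>p. F (snd p)) summable_on Sigma V (Chi V E)"
    using summable_on_reindex_bij_betw[OF bij_betw_Sigma_Chi] assms by metis
  from infsum_Sigma_banach[OF this] show ?thesis
    using infsum_reindex_bij_betw[OF bij_betw_Sigma_Chi, of F] by simp
qed

end


section \<open>Weighted shifts with square summable weights\<close>

text \<open>Dense definedness of the shift enters the proof through \<open>weights\<close>;
  \<open>densely_defined_imp_weights_summable\<close> derives it.\<close>

locale weighted_tree = directed_tree +
  fixes w :: "'v \<Rightarrow> complex"
  assumes weights: "u \<in> V \<Longrightarrow> (\<lambda>v. (cmod (w v))\<^sup>2) summable_on Chi V E u"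
begin

definition a :: "'v \<Rightarrow> real" where
  "a u = (\<Sum>\<^sub>\<infinity>v\<in>Chi V E u. (cmod (w v))\<^sup>2)"

definition s :: "'v \<Rightarrow> real" where
  "s u = (\<Sum>\<^sub>\<infinity>v\<in>Chi V E u. (cmod (w v))\<^sup>2 / (1 + a v))"

lemma a_nonneg: "a u \<ge> 0"
  unfolding a_def by (intro infsum_nonneg) auto

lemma one_plus_a_pos: "1 + a u > 0"
  using a_nonneg[of u] by simp

text \<open>Since \<open>1 + a v\<close> is at least \<open>1\<close>, the squared weights dominate;
  thus \<open>s u\<close> is a genuine sum, not the default value of a divergent one.\<close>

lemma s_summable: "u \<in> V \<Longrightarrow> (\<lambda>v. (cmod (w v))\<^sup>2 / (1 + a v)) summable_on Chi V E u"
proof (rule summable_on_comparison_test[OF weights])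
  fix v
  show "(cmod (w v))\<^sup>2 / (1 + a v) \<le> (cmod (w v))\<^sup>2"
    using mult_left_mono[of 1 "1 + a v" "(cmod (w v))\<^sup>2"] a_nonneg[of v] one_plus_a_pos[of v]
    by (simp add: divide_le_eq)
  show "0 \<le> (cmod (w v))\<^sup>2 / (1 + a v)"
    using one_plus_a_pos[of v] by simp
qed

section \<open>The domain of the shift and its action on basis vectors\<close>

lemma infsum_shift_Chi:
  assumes "u \<in> V"
  shows "(\<lambda>v. (cmod (shift_map V E w f v))\<^sup>2) summable_on Chi V E u"
    and "(\<Sum>\<^sub>\<infinity>v\<in>Chi V E u. (cmod (shift_map V E w f v))\<^sup>2) = a u * (cmod (f u))\<^sup>2"
proof -
  \<comment> \<open>On the children of \<open>u\<close>, the composition of \<open>f\<close> with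
    the parent map is the constant \<open>f u\<close>.\<close>
  have eq: "(cmod (shift_map V E w f v))\<^sup>2 = (cmod (w v))\<^sup>2 * (cmod (f u))\<^sup>2"
    if "v \<in> Chi V E u" for v
    using that par_eq[OF assms that] Chi_subset_nonroots[OF assms]
    by (auto simp: shift_map_def norm_mult power_mult_distrib)
  show "(\<lambda>v. (cmod (shift_map V E w f v))\<^sup>2) summable_on Chi V E u"
    using summable_on_cmult_left[OF weights[OF assms]] eq by (simp cong: summable_on_cong)
  show "(\<Sum>\<^sub>\<infinity>v\<in>Chi V E u. (cmod (shift_map V E w f v))\<^sup>2) = a u * (cmod (f u))\<^sup>2"
    using eq by (simp add: a_def infsum_cmult_left' cong: infsum_cong)
qed

lemma shift_summable_iff:
  "(\<lambda>v. (cmod (shift_map V E w f v))\<^sup>2) summable_on V \<longleftrightarrow>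
    (\<lambda>u. a u * (cmod (f u))\<^sup>2) summable_on V"
proof -
  have "(\<lambda>v. (cmod (shift_map V E w f v))\<^sup>2) summable_on V \<longleftrightarrow>
      (\<lambda>v. (cmod (shift_map V E w f v))\<^sup>2) summable_on nonroots V E"
    by (rule summable_on_cong_neutral) (use nonroots_subset in \<open>auto simp: shift_map_def\<close>)
  also have "\<dots> \<longleftrightarrow> (\<lambda>u. \<Sum>\<^sub>\<infinity>v\<in>Chi V E u. (cmod (shift_map V E w f v))\<^sup>2) summable_on V"
    by (intro summable_on_nonroots_iff infsum_shift_Chi) auto
  also have "\<dots> \<longleftrightarrow> (\<lambda>u. a u * (cmod (f u))\<^sup>2) summable_on V"
    by (intro summable_on_cong infsum_shift_Chi)
  finally show ?thesis .
qed

lemma shift_in_ell2_iff: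
  "shift_map V E w f \<in> ell2 V \<longleftrightarrow> (\<lambda>u. a u * (cmod (f u))\<^sup>2) summable_on V"
  using shift_summable_iff[of f] nonroots_subset by (auto simp: ell2_def shift_map_def)

text \<open>The sum of \<open>(1 + a u) * (cmod (f u))\<^sup>2\<close> is the squared graph norm of
  \<open>f\<close>. It splits into the squared norms of \<open>f\<close> and of its image, and both
  parts have nonnegative terms.\<close>

lemma domain_iff:
  "f \<in> op_domain (weighted_shift V E w) \<longleftrightarrow>
    (\<forall>v. v \<notin> V \<longrightarrow> f v = 0) \<and> (\<lambda>u. (1 + a u) * (cmod (f u))\<^sup>2) summable_on V"
proof -
  have "(\<lambda>u. (1 + a u) * (cmod (f u))\<^sup>2) summable_on V \<longleftrightarrow>
      (\<lambda>u. (cmod (f u))\<^sup>2) summable_on V \<and> (\<lambda>u. a u * (cmod (f u))\<^sup>2) summable_on V"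
  proof
    assume *: "(\<lambda>u. (1 + a u) * (cmod (f u))\<^sup>2) summable_on V"
    show "(\<lambda>u. (cmod (f u))\<^sup>2) summable_on V \<and> (\<lambda>u. a u * (cmod (f u))\<^sup>2) summable_on V"
      using a_nonneg
      by (intro conjI summable_on_comparison_test[OF *]) (auto simp: algebra_simps)
  next
    assume "(\<lambda>u. (cmod (f u))\<^sup>2) summable_on V \<and> (\<lambda>u. a u * (cmod (f u))\<^sup>2) summable_on V"
    then show "(\<lambda>u. (1 + a u) * (cmod (f u))\<^sup>2) summable_on V"
      by (simp add: distrib_right summable_on_add)
  qed
  then show ?thesis
    using shift_in_ell2_iff[of f] by (auto simp: weighted_shift_def ell2_def)
qed

lemma shift_basis:
  assumes "u \<in> V"
  shows "shift_map V E w (ell2_basis u) v = (if v \<in> Chi V E u then w v else 0)"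
proof (cases "v \<in> nonroots V E")
  case True
  then obtain u' where u': "u' \<in> V" "v \<in> Chi V E u'"
    by (auto simp: nonroots_def is_root_def Chi_def)
  then have "par V E v = u'"
    by (rule par_eq)
  moreover have "v \<in> Chi V E u \<longleftrightarrow> u' = u"
    using u' assms par_eq by metis
  ultimately show ?thesis
    using True by (simp add: shift_map_def ell2_basis_def)
next
  case False
  then show ?thesis
    using Chi_subset_nonroots[OF assms] by (auto simp: shift_map_def)
qed

lemma ell2_norm_shift_basis:
  assumes "u \<in> V"
  shows "(ell2_norm V (op_apply (weighted_shift V E w) (ell2_basis u)))\<^sup>2 = a u"
proof -
  have "(\<Sum>\<^sub>\<infinity>v\<in>V. (cmod (shift_map V E w (ell2_basis u) v))\<^sup>2) = a u"
    unfolding a_def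
    by (rule infsum_cong_neutral) (use assms in \<open>auto simp: shift_basis Chi_def\<close>)
  then show ?thesis
    by (simp add: ell2_norm_def weighted_shift_def a_nonneg)
qed

lemma basis_in_domain: "u \<in> V \<Longrightarrow> ell2_basis u \<in> op_domain (weighted_shift V E w)"
proof -
  assume u: "u \<in> V"
  have "(\<lambda>v. a v * (cmod (ell2_basis u v))\<^sup>2) summable_on V \<longleftrightarrow>
      (\<lambda>v. a v * (cmod (ell2_basis u v))\<^sup>2) summable_on {u}"
    by (rule summable_on_cong_neutral) (use u in \<open>auto simp: ell2_basis_def\<close>)
  then show ?thesis
    using ell2_basis_in_ell2[OF u] shift_in_ell2_iff by (auto simp: weighted_shift_def)
qed

section \<open>Sufficiency of the bound on \<open>s\<close>\<close>

lemma bounded_imp_domain_subset: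
  assumes c: "\<And>u. u \<in> V \<Longrightarrow> s u \<le> c"
  shows "op_domain (weighted_shift V E w) \<subseteq> op_domain (op_adjoint V (weighted_shift V E w))"
proof
  fix f assume f: "f \<in> op_domain (weighted_shift V E w)"
  \<comment> \<open>\<open>h\<close> is the candidate for the adjoint at \<open>f\<close>, set to
    \<open>0\<close> off \<open>V\<close> as membership in \<open>ell2 V\<close> demands. The terms
    \<open>B v\<close> are those of the squared graph norm of \<open>f\<close>.\<close>
  define h where "h u = (if u \<in> V then \<Sum>\<^sub>\<infinity>v\<in>Chi V E u. cnj (w v) * f v else 0)" for u
  define B where "B v = (1 + a v) * (cmod (f v))\<^sup>2" for v
  have f2: "f \<in> ell2 V"
    using f by (simp add: weighted_shift_def)
  have B0: "B v \<ge> 0" for v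
    using one_plus_a_pos[of v] by (simp add: B_def)
  have BV: "B summable_on V"
    using f unfolding domain_iff B_def by blast
  then have BN: "B summable_on nonroots V E"
    using nonroots_subset by (rule summable_on_subset_banach)
  have BC: "B summable_on Chi V E u" for u
    using BV by (rule summable_on_subset_banach) (auto simp: Chi_def)
  have bound: "(cmod (h u))\<^sup>2 \<le> c * infsum B (Chi V E u)" if u: "u \<in> V" for u
  proof -
    \<comment> \<open>The factor \<open>sqrt (1 + a v)\<close> is moved from the weight to
      \<open>f\<close>, so that the squares of \<open>x\<close> sum to \<open>s u\<close> and those
      of \<open>y\<close> to the share of the graph norm carried by
      \<open>Chi V E u\<close>.\<close>
    define x where "x v = cmod (w v) / sqrt (1 + a v)" for v
    define y where "y v = sqrt (1 + a v) * cmod (f v)" for v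
    have x2: "(x v)\<^sup>2 = (cmod (w v))\<^sup>2 / (1 + a v)" for v
      using one_plus_a_pos[of v] by (simp add: x_def power_divide)
    have y2: "(y v)\<^sup>2 = B v" for v
      using one_plus_a_pos[of v] by (simp add: y_def B_def power_mult_distrib)
    have xy: "norm (cnj (w v) * f v) = x v * y v" for v
      using one_plus_a_pos[of v] by (simp add: x_def y_def norm_mult)
    note CS = Cauchy_Schwarz_infsum[of x "Chi V E u" y, unfolded x2 y2, OF s_summable[OF u] BC]
    have "cmod (h u) \<le> (\<Sum>\<^sub>\<infinity>v\<in>Chi V E u. norm (cnj (w v) * f v))"
      using u norm_infsum_bound[of "\<lambda>v. cnj (w v) * f v" "Chi V E u"] CS(1)
      unfolding xy by (simp add: h_def)
    then have "(cmod (h u))\<^sup>2 \<le> (\<Sum>\<^sub>\<infinity>v\<in>Chi V E u. x v * y v)\<^sup>2"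
      by (intro power_mono) (simp_all add: xy)
    also have "\<dots> \<le> s u * infsum B (Chi V E u)"
      using CS(2) by (simp add: s_def)
    also have "\<dots> \<le> c * infsum B (Chi V E u)"
      using c[OF u] B0 by (intro mult_right_mono infsum_nonneg)
    finally show ?thesis .
  qed
  \<comment> \<open>The shares add up to the sum of \<open>B\<close> over the non-roots, so the
    bounds on \<open>h\<close> are summable over \<open>V\<close>.\<close>
  have "(\<lambda>u. infsum B (Chi V E u)) summable_on V"
    using BN summable_on_nonroots_iff[OF B0 BC] by blast
  then have "(\<lambda>u. c * infsum B (Chi V E u)) summable_on V"
    by (rule summable_on_cmult_right)
  then have "(\<lambda>u. (cmod (h u))\<^sup>2) summable_on V"
    by (rule summable_on_comparison_test) (use bound in auto)
  then have h2: "h \<in> ell2 V"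
    by (auto simp: ell2_def h_def)
  have "ell2_inner V (op_apply (weighted_shift V E w) g) f = ell2_inner V g h"
    if g: "g \<in> op_domain (weighted_shift V E w)" for g
  proof -
    let ?F = "\<lambda>v. shift_map V E w g v * cnj (f v)"
    have "?F summable_on V"
      using g f2 by (intro ell2_inner_summable) (auto simp: weighted_shift_def)
    then have F: "?F summable_on nonroots V E"
      using nonroots_subset by (rule summable_on_subset_banach)
    have "infsum ?F V = infsum ?F (nonroots V E)"
      by (rule infsum_cong_neutral) (use nonroots_subset in \<open>auto simp: shift_map_def\<close>)
    also have "\<dots> = (\<Sum>\<^sub>\<infinity>u\<in>V. infsum ?F (Chi V E u))"
      by (rule infsum_nonroots[OF F])
    also have "\<dots> = (\<Sum>\<^sub>\<infinity>u\<in>V. g u * cnj (h u))"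
    proof (rule infsum_cong)
      fix u assume u: "u \<in> V"
      \<comment> \<open>On these children \<open>g\<close> is evaluated at \<open>u\<close> only, so
        \<open>g u\<close> leaves the sum and the conjugate of \<open>h u\<close> remains.\<close>
      have "infsum ?F (Chi V E u) = (\<Sum>\<^sub>\<infinity>v\<in>Chi V E u. g u * cnj (cnj (w v) * f v))"
        by (rule infsum_cong)
          (use par_eq[OF u] Chi_subset_nonroots[OF u] in \<open>auto simp: shift_map_def\<close>)
      also have "\<dots> = g u * cnj (h u)"
        using u by (simp only: infsum_cmult_right' infsum_cnj h_def if_True)
      finally show "infsum ?F (Chi V E u) = g u * cnj (h u)" .
    qed
    finally show ?thesis
      by (simp add: ell2_inner_def weighted_shift_def)
  qed
  then show "f \<in> op_domain (op_adjoint V (weighted_shift V E w))"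
    using f2 h2 by (auto simp: op_adjoint_def)
qed

section \<open>Necessity of the bound on \<open>s\<close>\<close>

lemma adjoint_domain_imp_summable:
  assumes "f \<in> op_domain (op_adjoint V (weighted_shift V E w))"
  shows "(\<lambda>u. (cmod (\<Sum>\<^sub>\<infinity>v\<in>Chi V E u. w v * cnj (f v)))\<^sup>2) summable_on V"
proof -
  obtain h where h: "h \<in> ell2 V" "\<And>g. g \<in> op_domain (weighted_shift V E w) \<Longrightarrow>
      ell2_inner V (op_apply (weighted_shift V E w) g) f = ell2_inner V g h"
    using assms by (auto simp: op_adjoint_def)
  \<comment> \<open>Testing the adjoint identity on \<open>ell2_basis u\<close> isolates
    \<open>h u\<close>, conjugated because the inner product is conjugate linear in its second
    argument.\<close>
  have "(\<Sum>\<^sub>\<infinity>v\<in>Chi V E u. w v * cnj (f v)) = cnj (h u)" if u: "u \<in> V" for u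
  proof -
    have "(\<Sum>\<^sub>\<infinity>v\<in>Chi V E u. w v * cnj (f v)) =
        ell2_inner V (op_apply (weighted_shift V E w) (ell2_basis u)) f"
      unfolding ell2_inner_def
      by (rule infsum_cong_neutral)
        (use u in \<open>auto simp: weighted_shift_def shift_basis Chi_def\<close>)
    also have "\<dots> = ell2_inner V (ell2_basis u) h"
      by (intro h(2) basis_in_domain u)
    also have "\<dots> = (\<Sum>\<^sub>\<infinity>v\<in>{u}. cnj (h v))"
      unfolding ell2_inner_def
      by (rule infsum_cong_neutral) (use u in \<open>auto simp: ell2_basis_def\<close>)
    finally show ?thesis by simp
  qed
  then show ?thesis
    using h(1) by (simp add: ell2_def cong: summable_on_cong)
qed

lemma unbounded_imp_not_domain_subset:
  assumes unbdd: "\<And>c. \<exists>u\<in>V. s u > c"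
  shows "\<not> op_domain (weighted_shift V E w) \<subseteq> op_domain (op_adjoint V (weighted_shift V E w))"
proof
  assume sub: "op_domain (weighted_shift V E w) \<subseteq> op_domain (op_adjoint V (weighted_shift V E w))"
  \<comment> \<open>The powers of two make the reciprocals \<open>1 / s (u n)\<close> summable; the
    strict increase of \<open>s\<close> along the sequence makes its vertices distinct.\<close>
  have "\<exists>u :: nat \<Rightarrow> 'v. \<forall>n. (u n \<in> V \<and> 2 ^ n < s (u n)) \<and> s (u n) < s (u (Suc n))"
  proof (rule dependent_nat_choice)
    show "\<exists>x. x \<in> V \<and> 2 ^ 0 < s x"
      using unbdd by blast
    show "\<exists>y. (y \<in> V \<and> 2 ^ Suc n < s y) \<and> s x < s y" for x n
      using unbdd[of "max (2 ^ Suc n) (s x)"] by auto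
  qed
  then obtain u :: "nat \<Rightarrow> 'v" where uV: "\<And>n. u n \<in> V" and s_ge: "\<And>n. 2 ^ n < s (u n)"
    and s_mono: "\<And>n. s (u n) < s (u (Suc n))" by blast
  have "strict_mono (\<lambda>n. s (u n))"
    by (intro strict_mono_Suc_iff[THEN iffD2] allI s_mono)
  then have inj: "inj u"
    by (metis injI strict_mono_eq)
  have s_pos: "s (u n) > 0" for n
    using s_ge[of n] by (smt (verit) zero_less_power)
  \<comment> \<open>On each selected set of children, \<open>w v / (1 + a v)\<close> is the equality
    case of the weighted Cauchy-Schwarz inequality. Dividing by \<open>s\<close> of the parent
    normalises the pairing with the weights to \<open>1\<close>.\<close>
  define f where "f v = (if v \<in> nonroots V E \<and> par V E v \<in> range u
      then w v / of_real ((1 + a v) * s (par V E v)) else 0)" for v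
  let ?B = "\<lambda>v. (1 + a v) * (cmod (f v))\<^sup>2"
  have fChi: "f v = (if x \<in> range u then w v / of_real ((1 + a v) * s x) else 0)"
    if "x \<in> V" "v \<in> Chi V E x" for x v
    using that par_eq[OF that] Chi_subset_nonroots[OF that(1)] by (auto simp: f_def)
  have BChi: "?B v = (if x \<in> range u then (1 / (s x)\<^sup>2) * ((cmod (w v))\<^sup>2 / (1 + a v)) else 0)"
    if "x \<in> V" "v \<in> Chi V E x" for x v
    using one_plus_a_pos[of v] s_pos fChi[OF that]
    by (auto simp: norm_divide norm_mult power_divide power_mult_distrib power2_eq_square
        abs_mult simp del: of_real_add of_real_mult)
  have B_summable: "?B summable_on Chi V E x" if "x \<in> V" for x
  proof -
    have "(\<lambda>v. if x \<in> range u then (1 / (s x)\<^sup>2) * ((cmod (w v))\<^sup>2 / (1 + a v)) else 0)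
        summable_on Chi V E x"
      using summable_on_cmult_right[OF s_summable[OF that], of "1 / (s x)\<^sup>2"]
      by (cases "x \<in> range u") (simp_all only: if_True if_False summable_on_0)
    then show ?thesis
      by (subst summable_on_cong[OF BChi[OF that]])
  qed
  have B_infsum: "infsum ?B (Chi V E x) = (if x \<in> range u then 1 / s x else 0)" if "x \<in> V" for x
  proof (cases "x \<in> range u")
    case True
    then have "infsum ?B (Chi V E x) =
        (\<Sum>\<^sub>\<infinity>v\<in>Chi V E x. (1 / (s x)\<^sup>2) * ((cmod (w v))\<^sup>2 / (1 + a v)))"
      using BChi[OF that] by (intro infsum_cong) simp
    also have "\<dots> = (1 / (s x)\<^sup>2) * s x"
      by (simp only: s_def infsum_cmult_right')
    finally show ?thesis
      using True s_pos by (auto simp: power2_eq_square)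
  next
    case False
    then show ?thesis
      using BChi[OF that] by (auto intro: infsum_0)
  qed
  have "summable (\<lambda>n. 1 / s (u n))"
  proof (rule summable_comparison_test)
    show "summable (\<lambda>n. (1 / 2 :: real) ^ n)"
      by (rule summable_geometric) simp
    show "\<exists>N. \<forall>n\<ge>N. norm (1 / s (u n)) \<le> (1 / 2) ^ n"
    proof (intro exI allI impI)
      show "norm (1 / s (u n)) \<le> (1 / 2) ^ n" for n
        using frac_le[of 1 1 "2 ^ n" "s (u n)"] s_ge[of n] s_pos[of n] by (simp add: power_one_over)
    qed
  qed
  then have "(\<lambda>n. 1 / s (u n)) summable_on UNIV"
    by (rule summable_nonneg_imp_summable_on) (simp add: s_pos less_imp_le)
  then have "(\<lambda>x. 1 / s x) summable_on range u"
    using summable_on_reindex[OF inj, of "\<lambda>x. 1 / s x"] by (simp add: o_def)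
  also have "?this \<longleftrightarrow> (\<lambda>x. infsum ?B (Chi V E x)) summable_on V"
    by (rule summable_on_cong_neutral) (use uV B_infsum in auto)
  finally have "?B summable_on nonroots V E"
    by (subst summable_on_nonroots_iff) (auto intro!: B_summable mult_nonneg_nonneg less_imp_le[OF one_plus_a_pos])
  \<comment> \<open>The only vertex that may be missing is the root, where \<open>f\<close> is
    \<open>0\<close>.\<close>
  also have "?this \<longleftrightarrow> ?B summable_on V"
    by (rule summable_on_cong_neutral) (use nonroots_subset in \<open>auto simp: f_def\<close>)
  finally have "f \<in> op_domain (weighted_shift V E w)"
    unfolding domain_iff using nonroots_subset by (auto simp: f_def)
  then have "(\<lambda>x. (cmod (\<Sum>\<^sub>\<infinity>v\<in>Chi V E x. w v * cnj (f v)))\<^sup>2) summable_on V"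
    using sub adjoint_domain_imp_summable by blast
  then have "(\<lambda>x. (cmod (\<Sum>\<^sub>\<infinity>v\<in>Chi V E x. w v * cnj (f v)))\<^sup>2) summable_on range u"
    by (rule summable_on_subset_banach) (use uV in auto)
  \<comment> \<open>By the normalisation of \<open>f\<close>, every inner sum over a selected set of
    children is \<open>s x / s x\<close>. As \<open>u\<close> is injective, the constant
    \<open>1\<close> would then be summable over the natural numbers.\<close>
  also have "?this \<longleftrightarrow> (\<lambda>x. 1 :: real) summable_on range u"
  proof (rule summable_on_cong)
    fix x assume x: "x \<in> range u"
    then have xV: "x \<in> V" and sx: "s x > 0"
      using uV s_pos by auto
    have "(\<Sum>\<^sub>\<infinity>v\<in>Chi V E x. w v * cnj (f v)) =
        (\<Sum>\<^sub>\<infinity>v\<in>Chi V E x. of_real ((1 / s x) * ((cmod (w v))\<^sup>2 / (1 + a v))))"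
      by (rule infsum_cong)
        (use x fChi[OF xV] in \<open>auto simp: complex_norm_square mult_ac simp del: of_real_power\<close>)
    also have "\<dots> = of_real ((1 / s x) * s x)"
      using s_summable[OF xV]
      by (intro infsumI has_sum_of_real has_sum_cmult_right) (simp add: s_def)
    also have "\<dots> = 1"
      using sx by simp
    finally show "(cmod (\<Sum>\<^sub>\<infinity>v\<in>Chi V E x. w v * cnj (f v)))\<^sup>2 = 1" by simp
  qed
  also have "\<dots> \<longleftrightarrow> (\<lambda>n :: nat. 1 :: real) summable_on UNIV"
    using summable_on_reindex[OF inj, of "\<lambda>x. 1 :: real"] by (simp add: o_def)
  finally have "summable (\<lambda>n :: nat. 1 :: real)"
    by (rule summable_on_imp_summable)
  then show False
    using summable_LIMSEQ_zero LIMSEQ_unique tendsto_const zero_neq_one by metis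
qed

end

text \<open>An element \<open>g\<close> of the domain at distance less than \<open>1\<close> from
  \<open>ell2_basis u\<close> cannot vanish at \<open>u\<close>. Its image is square summable and
  equals \<open>w v * g u\<close> on the children of \<open>u\<close>, so the nonzero factor
  \<open>g u\<close> can be cancelled.\<close>

lemma densely_defined_imp_weights_summable:
  assumes "directed_tree V E" and dense: "densely_defined V (weighted_shift V E w)" and u: "u \<in> V"
  shows "(\<lambda>v. (cmod (w v))\<^sup>2) summable_on Chi V E u"
proof -
  interpret directed_tree V E by fact
  obtain g where g: "g \<in> op_domain (weighted_shift V E w)"
    and close: "ell2_norm V (\<lambda>v. ell2_basis u v - g v) < 1"
    using dense ell2_basis_in_ell2[OF u] unfolding densely_defined_def
    by (meson zero_less_one)
  have "g \<in> ell2 V"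
    using g by (simp add: weighted_shift_def)
  then have "cmod (ell2_basis u u - g u) < 1"
    using norm_le_ell2_norm[OF ell2_diff[OF ell2_basis_in_ell2[OF u]] u, of g] close by simp
  then have gu: "g u \<noteq> 0"
    by (auto simp: ell2_basis_def)
  have "(\<lambda>v. (cmod (shift_map V E w g v))\<^sup>2) summable_on V"
    using g by (simp add: weighted_shift_def ell2_def)
  then have "(\<lambda>v. (cmod (shift_map V E w g v))\<^sup>2) summable_on Chi V E u"
    by (rule summable_on_subset_banach) (auto simp: Chi_def)
  also have "?this \<longleftrightarrow> (\<lambda>v. (cmod (w v))\<^sup>2 * (cmod (g u))\<^sup>2) summable_on Chi V E u"
    by (rule summable_on_cong)
      (use par_eq[OF u] Chi_subset_nonroots[OF u] in
        \<open>auto simp: shift_map_def norm_mult power_mult_distrib\<close>)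
  finally show ?thesis
    using gu by (simp add: summable_on_cmult_left')
qed

text \<open>Summability is stated beside the bound because \<open>infsum\<close> of a divergent
  family is \<open>0\<close> by convention.\<close>

theorem theorem4p1p1:
  fixes V :: "'v set" and E :: "('v \<times> 'v) set" and w :: "'v \<Rightarrow> complex"
  assumes "directed_tree V E"
    and "densely_defined V (weighted_shift V E w)"
  shows "op_domain (weighted_shift V E w) \<subseteq> op_domain (op_adjoint V (weighted_shift V E w)) \<longleftrightarrow>
    (\<exists>c>0. \<forall>u\<in>V.
       (\<lambda>v. (cmod (w v))\<^sup>2 / (1 + (ell2_norm V (op_apply (weighted_shift V E w) (ell2_basis v)))\<^sup>2))
         summable_on Chi V E u \<and>
       (\<Sum>\<^sub>\<infinity>v\<in>Chi V E u.
          (cmod (w v))\<^sup>2 / (1 + (ell2_norm V (op_apply (weighted_shift V E w) (ell2_basis v)))\<^sup>2)) \<le> c)"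
    (is "?i \<longleftrightarrow> (\<exists>c>0. \<forall>u\<in>V. ?t summable_on Chi V E u \<and> infsum ?t (Chi V E u) \<le> c)")
proof -
  interpret directed_tree V E by fact
  interpret weighted_tree V E w
    by unfold_locales (rule densely_defined_imp_weights_summable[OF assms])
  have t: "?t v = (cmod (w v))\<^sup>2 / (1 + a v)" if "v \<in> Chi V E u" for u v
    using that by (subst ell2_norm_shift_basis) (auto simp: Chi_def)
  have t_summable: "?t summable_on Chi V E u" if "u \<in> V" for u
    using s_summable[OF that] by (subst summable_on_cong[OF t])
  have t_infsum: "infsum ?t (Chi V E u) = s u" for u
    unfolding s_def by (rule infsum_cong) (rule t)
  have "?i \<longleftrightarrow> (\<exists>c>0. \<forall>u\<in>V. s u \<le> c)"
  proof
    assume ?i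
    then obtain c where "\<forall>u\<in>V. s u \<le> c"
      using unbounded_imp_not_domain_subset by (meson not_le)
    \<comment> \<open>The bound obtained by contraposition may fail to be positive; the maximum with
      \<open>1\<close> repairs this.\<close>
    then have "\<forall>u\<in>V. s u \<le> max 1 c"
      by auto
    then show "\<exists>c>0. \<forall>u\<in>V. s u \<le> c"
      by (intro exI[of _ "max 1 c"]) auto
  next
    assume "\<exists>c>0. \<forall>u\<in>V. s u \<le> c"
    then show ?i
      using bounded_imp_domain_subset by blast
  qed
  then show ?thesis
    using t_summable t_infsum by simp
qed

end
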